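(* Let $M_3(\mathbb{C})=A\oplus B$ be a direct vector-space sum of two subalgebras with $\dim A=3$ and $\dim B=6$, where $A$ is unital. Then there is a map $\varphi\colon M_3(\mathbb{C})\to M_3(\mathbb{C})$, which is an automorphism or an antiautomorphism of $M_3(\mathbb{C})$, such that $\varphi(B)=\mathrm{Span}\{e_{12},e_{13},e_{22},e_{23},e_{32},e_{33}\}$ and $\varphi(A)=S$, where $S$ is one of the following subalgebras: (S1) $\mathrm{Span}\{E,e_{21},e_{31}\}$; (S2) $\mathrm{Span}\{E,e_{21},e_{31}+e_{23}\}$; (S3) $\mathrm{Span}\{E,e_{21}+e_{22},e_{31}\}$; (S4) $\mathrm{Span}\{E,e_{21}+e_{22}+e_{33},e_{31}+e_{32}\}$; (S5) $\mathrm{Span}\{E,e_{21}+e_{22}+e_{33},e_{31}\}$; (S6) $\mathrm{Span}\{E,e_{21}+e_{22},e_{31}+e_{32}\}$; (S7) $\mathrm{Span}\{E,e_{21}+e_{22},e_{31}+e_{33}\}$; (S8) $\mathrm{Span}\{E,\ e_{21}+(1-y)e_{22}+e_{23},\ e_{31}+e_{22}+e_{23}+ye_{33}\}$ for some $y\in\mathbb{C}$, $y\neq0$; (S9) $\mathrm{Span}\{E,\ e_{21}+e_{22}+e_{33},\ e_{31}+e_{32}+e_{23}+ye_{33}\}$ for some $y\in\mathbb{C}$, $y\neq0$; (S10) $\mathrm{Span}\left\{E,\begin{pmatrix}0&0&0\\1&d&1\\0&1/f&1\end{pmatrix},\begin{pmatrix}0&0&0\\0&1&f\\1&1&1+f(1-d)\end{pmatrix}\right\}$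 for some $d,f\in\mathbb{C}$, $f\neq0$; (S11) $\mathrm{Span}\{E,\ e_{21}+e_{13}+de_{23}+e_{32},\ e_{31}+e_{12}+e_{23}+d(e_{22}+e_{33})\}$ for some $d\in\mathbb{C}$; (S12) $\mathrm{Span}\left\{E,\begin{pmatrix}0&0&eu-1\\1&1&1\\0&e&1\end{pmatrix},\begin{pmatrix}0&eu-1&0\\0&1&u\\1&1&1\end{pmatrix}\right\}$ for some $e,u\in\mathbb{C}$, $e\neq0$, $eu\neq1$.
   Context: $M_3(\mathbb{C})$ is the algebra of $3\times3$ complex matrices, $e_{ij}$ are the matrix units, $E$ is the identity matrix, and $\mathrm{Span}$ means linear span over $\mathbb{C}$. A subalgebra is a $\mathbb{C}$-linear subspace closed under multiplication; it is called unital if it contains $E$. An automorphism is a $\mathbb{C}$-algebra automorphism of $M_3(\mathbb{C})$; an antiautomorphism is the composition of an automorphism and the transpose map. The phrase "up to transpose and up to action of $\mathrm{Aut}(M_3(\mathbb{C}))$" is expressed in the claim by the existence of $\varphi$. *)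

theory Defs
  imports "HOL-Analysis.Analysis"
begin

text \<open>
  The scalar multiplications already available on \<open>complex ^ 'n ^ 'm\<close> are not the one of a complex
  vector space: \<open>*\<^sub>R\<close> only takes real scalars, and \<open>*s\<close> takes scalars that are row vectors.
  Spans, dimensions and linear maps below are taken with respect to the following
  multiplication instead.
\<close>

definition mat_scale :: "'a::field \<Rightarrow> 'a ^ 'n ^ 'm \<Rightarrow> 'a ^ 'n ^ 'm"  (infixr \<open>*\<^sub>M\<close> 75)
  where "c *\<^sub>M X = (\<chi> i j. c * X $ i $ j)"

global_interpretation matsp: vector_space "(*\<^sub>M) :: 'a::field \<Rightarrow> 'a ^ 'n ^ 'm \<Rightarrow> 'a ^ 'n ^ 'm"
  by unfold_locales (simp_all add: mat_scale_def vec_eq_iff algebra_simps)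

definition mat_unit :: "'n \<Rightarrow> 'n \<Rightarrow> 'a::field ^ 'n ^ 'n"
  where "mat_unit k l = (\<chi> i j. if i = k \<and> j = l then 1 else 0)"

definition subalgebra :: "('a::field ^ 'n ^ 'n) set \<Rightarrow> bool"
  where "subalgebra A \<longleftrightarrow> matsp.subspace A \<and> (\<forall>X\<in>A. \<forall>Y\<in>A. X ** Y \<in> A)"

definition unital :: "('a::field ^ 'n ^ 'n) set \<Rightarrow> bool"
  where "unital A \<longleftrightarrow> mat 1 \<in> A"

definition automorphism :: "('a::field ^ 'n ^ 'n \<Rightarrow> 'a ^ 'n ^ 'n) \<Rightarrow> bool"
  where "automorphism \<phi> \<longleftrightarrow>
    Vector_Spaces.linear (*\<^sub>M) (*\<^sub>M) \<phi> \<and> bij \<phi> \<and> \<phi> (mat 1) = mat 1 \<and>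
    (\<forall>X Y. \<phi> (X ** Y) = \<phi> X ** \<phi> Y)"

definition antiautomorphism :: "('a::field ^ 'n ^ 'n \<Rightarrow> 'a ^ 'n ^ 'n) \<Rightarrow> bool"
  where "antiautomorphism \<phi> \<longleftrightarrow> (\<exists>\<psi>. automorphism \<psi> \<and> \<phi> = \<psi> \<circ> transpose)"

end

theory Submission
  imports Defs "HOL-Computational_Algebra.Fundamental_Theorem_Algebra"
begin

text \<open>
  The proof separates the two summands: first \<open>B\<close> is shown to be the annihilator of a
  vector, and then \<open>A\<close> becomes the left regular representation of an abstract algebra of
  dimension 3, of which there are only five.

  The subalgebra \<open>B\<close>. Let the identity matrix \<open>E\<close>, \<open>a\<close> and \<open>b\<close> be a basis of \<open>A\<close>; it is
  also a basis of the matrices modulo \<open>B\<close>, so every matrix has three coordinates that are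
  linear functionals vanishing on \<open>B\<close>. For \<open>X \<in> B\<close>, left multiplication by \<open>X\<close> annihilates
  \<open>B\<close> and \<open>E\<close> modulo \<open>B\<close>, so the coordinates of \<open>X Y\<close> depend on the last two coordinates
  of \<open>Y\<close> only. Restricted to matrices supported on a suitable column, these two
  coordinates become functionals on the space of vectors whose common kernel is invariant
  under \<open>B\<close>. That kernel is a line or a plane, so \<open>B\<close> or its transpose has a common
  eigenvector (lemma \<open>common_eigenvector\<close>). Transposing if necessary, let \<open>u\<close> be an
  eigenvector of \<open>B\<close>. Every vector is the image of \<open>u\<close> under a matrix, and \<open>B\<close> contributes
  only multiples of \<open>u\<close> to that image, so \<open>u, a u, b u\<close> form a basis. It follows that the
  algebra of all \<open>X\<close> with \<open>X u = 0\<close> lies in the sum of \<open>B\<close> and the scalars, where the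
  first coordinate is multiplicative. But this algebra has no nonzero character, being
  generated by nilpotent matrices of rank one; hence it lies in \<open>B\<close>, and since \<open>E \<notin> B\<close> it
  is equal to \<open>B\<close> (lemma \<open>eq_annihilator\<close>).

  The subalgebra \<open>A\<close>. With respect to the basis \<open>u, a u, b u\<close>, the vector \<open>u\<close> is the first
  unit vector, and the matrices of \<open>a\<close> and \<open>b\<close> can be read off the multiplication table of
  \<open>A\<close> (lemma \<open>normal_form_of_eigenvector\<close>). So only the isomorphism type of \<open>A\<close> matters.

  Unital complex algebras of dimension 3 (lemma \<open>unital_3dim_has_normal_basis\<close>). If
  \<open>E, X, X\<^sup>2\<close> are independent for some \<open>X\<close>, then \<open>A\<close> is a quotient of the polynomial ring
  by a cubic, and the three root patterns give three algebras. Otherwise every element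
  satisfies a quadratic equation; completing squares produces a nonzero element of square
  zero, and a short calculation leaves the algebra with zero product on the radical and
  the triangular \<open>2 \<times> 2\<close> matrices. Each of the five algebras is realised in the list.
\<close>

section \<open>Matrix arithmetic over a field\<close>

lemma mat_scale_mult_left: "(c *\<^sub>M X) ** Y = c *\<^sub>M (X ** Y)"
  for X Y :: "'a::field ^ 'n ^ 'n"
  by (simp add: mat_scale_def matrix_matrix_mult_def vec_eq_iff sum_distrib_left mult.assoc)

lemma mat_scale_mult_right: "X ** (c *\<^sub>M Y) = c *\<^sub>M (X ** Y)"
  for X Y :: "'a::field ^ 'n ^ 'n"
  by (simp add: mat_scale_def matrix_matrix_mult_def vec_eq_iff sum_distrib_left mult.left_commute)

lemma matrix_mult_uminus: "(- X) ** Y = - (X ** Y)" "X ** (- Y) = - (X ** Y)"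
  for X Y :: "'a::field ^ 'n ^ 'n"
  by (simp_all add: matrix_matrix_mult_def vec_eq_iff sum_negf)

lemma matrix_mult_add: "(X + Z) ** Y = X ** Y + Z ** Y" "X ** (Y + Z) = X ** Y + X ** Z"
  for X Y Z :: "'a::field ^ 'n ^ 'n"
  by (simp_all add: matrix_matrix_mult_def vec_eq_iff sum.distrib algebra_simps)

lemma matrix_mult_diff: "(X - Z) ** Y = X ** Y - Z ** Y" "X ** (Y - Z) = X ** Y - X ** Z"
  for X Y Z :: "'a::field ^ 'n ^ 'n"
  by (simp_all add: matrix_matrix_mult_def vec_eq_iff sum_subtractf algebra_simps)

lemma matrix_mult_zero: "0 ** X = 0" "X ** 0 = 0"
  for X :: "'a::field ^ 'n ^ 'n"
  by (simp_all add: matrix_matrix_mult_def vec_eq_iff)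

lemmas matrix_ring_simps = mat_scale_mult_left mat_scale_mult_right matrix_mult_uminus
  matrix_mult_diff matrix_mult_zero matrix_mult_add
  matrix_mul_lid matrix_mul_rid

lemmas entrywise = vec_eq_iff mat_scale_def

section \<open>Independent triples and three-dimensional subspaces\<close>

lemma mem_span_3:
  "X \<in> matsp.span {a, b, c} \<longleftrightarrow> (\<exists>x y z. X = x *\<^sub>M a + y *\<^sub>M b + z *\<^sub>M c)"
  for a :: "'a::field ^ 'n ^ 'm"
proof
  assume "X \<in> matsp.span {a, b, c}"
  then show "\<exists>x y z. X = x *\<^sub>M a + y *\<^sub>M b + z *\<^sub>M c"
    by (auto simp: matsp.span_insert algebra_simps; metis diff_eq_eq add.assoc add.commute)
next
  assume "\<exists>x y z. X = x *\<^sub>M a + y *\<^sub>M b + z *\<^sub>M c"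
  then show "X \<in> matsp.span {a, b, c}"
    by (elim exE) (simp add: matsp.span_add matsp.span_scale matsp.span_base)
qed

definition independent_3 :: "'a::field ^ 'n ^ 'm \<Rightarrow> 'a ^ 'n ^ 'm \<Rightarrow> 'a ^ 'n ^ 'm \<Rightarrow> bool"
  where "independent_3 a b c \<longleftrightarrow>
    (\<forall>x y z. x *\<^sub>M a + y *\<^sub>M b + z *\<^sub>M c = 0 \<longrightarrow> x = 0 \<and> y = 0 \<and> z = 0)"

lemma independent_3D:
  assumes "independent_3 a b c" and "x *\<^sub>M a + y *\<^sub>M b + z *\<^sub>M c = 0"
  shows "x = 0" "y = 0" "z = 0"
  using assms unfolding independent_3_def by blast+

lemma independent_3_imp_distinct:
  assumes "independent_3 a b c"
  shows "a \<noteq> b" "a \<noteq> c" "b \<noteq> c"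
  using independent_3D(1)[OF assms, of 1 "-1" 0] independent_3D(1)[OF assms, of 1 0 "-1"]
    independent_3D(2)[OF assms, of 0 1 "-1"]
  by auto

lemma independent_3_iff:
  "independent_3 a b c \<longleftrightarrow> \<not> matsp.dependent {a, b, c} \<and> a \<noteq> b \<and> a \<noteq> c \<and> b \<noteq> c"
proof
  assume i: "independent_3 a b c"
  note d = independent_3_imp_distinct[OF i]
  have "\<not> matsp.dependent {a, b, c}"
  proof
    assume "matsp.dependent {a, b, c}"
    then obtain u where u: "u a \<noteq> 0 \<or> u b \<noteq> 0 \<or> u c \<noteq> 0"
      and s: "(\<Sum>v\<in>{a, b, c}. u v *\<^sub>M v) = 0"
      by (auto simp: matsp.dependent_finite)
    have "u a *\<^sub>M a + u b *\<^sub>M b + u c *\<^sub>M c = 0"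
      using s d by (simp add: add.assoc)
    then show False using u independent_3D[OF i] by blast
  qed
  then show "\<not> matsp.dependent {a, b, c} \<and> a \<noteq> b \<and> a \<noteq> c \<and> b \<noteq> c"
    using d by blast
next
  assume r: "\<not> matsp.dependent {a, b, c} \<and> a \<noteq> b \<and> a \<noteq> c \<and> b \<noteq> c"
  show "independent_3 a b c" unfolding independent_3_def
  proof (intro allI impI)
    fix x y z assume e: "x *\<^sub>M a + y *\<^sub>M b + z *\<^sub>M c = 0"
    define u where "u = (\<lambda>v. if v = a then x else if v = b then y else z)"
    have "(\<Sum>v\<in>{a, b, c}. u v *\<^sub>M v) = 0" using r e by (auto simp: u_def add.assoc)
    then have "\<forall>v\<in>{a, b, c}. u v = 0"
      using r matsp.dependent_finite[of "{a, b, c}"] by blast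
    then show "x = 0 \<and> y = 0 \<and> z = 0" using r by (auto simp: u_def)
  qed
qed

text \<open>
  An element of \<open>V\<close> outside the span would give four independent elements in a space
  spanned by three.
\<close>

lemma span_of_independent_3:
  assumes "matsp.subspace V" "matsp.dim V = 3" "a \<in> V" "b \<in> V" "c \<in> V" "independent_3 a b c"
  shows "V = matsp.span {a, b, c}"
proof -
  obtain T where T: "T \<subseteq> V" "\<not> matsp.dependent T" "V \<subseteq> matsp.span T" "card T = 3"
    using matsp.basis_exists[of V] assms(2) by metis
  have "finite T" using T(4) card.infinite by fastforce
  have ind: "\<not> matsp.dependent {a, b, c}" and c3: "card {a, b, c} = 3"
    using assms(6) by (auto simp: independent_3_iff)
  have sub: "{a, b, c} \<subseteq> V" using assms(3-5) by blast
  have "V \<subseteq> matsp.span {a, b, c}"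
  proof
    fix X assume X: "X \<in> V"
    show "X \<in> matsp.span {a, b, c}"
    proof (rule ccontr)
      assume "X \<notin> matsp.span {a, b, c}"
      then have n: "X \<notin> {a, b, c}" "\<not> matsp.dependent (insert X {a, b, c})"
        using ind matsp.span_base[of X "{a, b, c}"] matsp.independent_insert[of X "{a, b, c}"]
        by (blast, metis)
      have "insert X {a, b, c} \<subseteq> matsp.span T" using X sub T(3) by blast
      then have "card (insert X {a, b, c}) \<le> card T"
        using matsp.independent_span_bound[OF \<open>finite T\<close> n(2)] by blast
      then show False using n(1) c3 T(4) by simp
    qed
  qed
  moreover have "matsp.span {a, b, c} \<subseteq> V"
    using assms by (intro matsp.span_minimal) auto
  ultimately show ?thesis by blast
qed

section \<open>Unital algebras of dimension 3\<close>

lemma monic_cubic_splits: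
  fixes c0 c1 c2 :: complex
  obtains p q r where "c2 = p + q + r" "c1 = - (p * q + p * r + q * r)" "c0 = p * q * r"
proof -
  have "\<not> constant (poly [:- c0, - c1, - c2, 1:])"
    by (simp add: constant_degree)
  then obtain p where p: "poly [:- c0, - c1, - c2, 1:] p = 0"
    using fundamental_theorem_of_algebra by blast
  have "\<not> constant (poly [:p * (p - c2) - c1, p - c2, 1:])"
    by (simp add: constant_degree)
  then obtain q where q: "poly [:p * (p - c2) - c1, p - c2, 1:] q = 0"
    using fundamental_theorem_of_algebra by blast
  have c0: "c0 = p * (p * (p - c2) - c1)"
    using p by (simp add: algebra_simps)
  have c1: "c1 = q * q + (p - c2) * q + p * (p - c2)"
    using q by (simp add: algebra_simps)
  show ?thesis
    by (rule that[of p q "c2 - p - q"]) (simp_all add: c0 c1 algebra_simps)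
qed

text \<open>
  The hypothesis on \<open>a1 * b2 - a2 * b1\<close> says that \<open>a\<close> and \<open>b\<close> are independent modulo \<open>e\<close>,
  being the determinant of their coefficients at \<open>n\<close> and \<open>y\<close>.
\<close>

lemma independent_3_change:
  assumes i: "independent_3 e n y" and d: "a1 * b2 - a2 * b1 \<noteq> 0"
    and a: "a = a0 *\<^sub>M e + a1 *\<^sub>M n + a2 *\<^sub>M y" and b: "b = b0 *\<^sub>M e + b1 *\<^sub>M n + b2 *\<^sub>M y"
  shows "independent_3 e a b"
  unfolding independent_3_def
proof (intro allI impI)
  fix s t u assume "s *\<^sub>M e + t *\<^sub>M a + u *\<^sub>M b = 0"
  then have "(s + t * a0 + u * b0) *\<^sub>M e + (t * a1 + u * b1) *\<^sub>M n + (t * a2 + u * b2) *\<^sub>M y = 0"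
    by (simp add: a b entrywise algebra_simps)
  note z = independent_3D[OF i this]
  have "t * (a1 * b2 - a2 * b1) = (t * a1 + u * b1) * b2 - (t * a2 + u * b2) * b1"
    "u * (a1 * b2 - a2 * b1) = (t * a2 + u * b2) * a1 - (t * a1 + u * b1) * a2"
    by (simp_all add: algebra_simps)
  then have "t = 0" "u = 0" using z(2,3) d by simp_all
  then show "s = 0 \<and> t = 0 \<and> u = 0" using z(1) by simp
qed

text \<open>
  If the identity, \<open>a\<close> and \<open>b\<close> are independent, the successive cases say that they span a
  copy of \<open>\<complex>[x, y] / (x, y)\<^sup>2\<close>, of \<open>\<complex>[x] / x\<^sup>3\<close>, of \<open>\<complex> \<times> \<complex>[x] / x\<^sup>2\<close>, of the triangular
  \<open>2 \<times> 2\<close> matrices (twice) and of \<open>\<complex> \<times> \<complex> \<times> \<complex>\<close>. The triangular algebra is listed with both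
  orders of multiplication so that the predicate is invariant under transposition.
\<close>

definition normal_table :: "complex ^ 3 ^ 3 \<Rightarrow> complex ^ 3 ^ 3 \<Rightarrow> bool"
  where "normal_table a b \<longleftrightarrow>
    a ** a = 0 \<and> a ** b = 0 \<and> b ** a = 0 \<and> b ** b = 0 \<or>
    a ** a = 0 \<and> a ** b = 0 \<and> b ** a = 0 \<and> b ** b = a \<or>
    a ** a = a \<and> a ** b = 0 \<and> b ** a = 0 \<and> b ** b = 0 \<or>
    a ** a = a \<and> a ** b = b \<and> b ** a = 0 \<and> b ** b = 0 \<or>
    a ** a = a \<and> a ** b = 0 \<and> b ** a = b \<and> b ** b = 0 \<or>
    a ** a = a \<and> a ** b = 0 \<and> b ** a = 0 \<and> b ** b = b"

definition has_normal_basis :: "(complex ^ 3 ^ 3) set \<Rightarrow> bool"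
  where "has_normal_basis A \<longleftrightarrow> (\<exists>a\<in>A. \<exists>b\<in>A. independent_3 (mat 1) a b \<and> normal_table a b)"

lemma subalgebraD:
  assumes "subalgebra A"
  shows "X \<in> A \<Longrightarrow> Y \<in> A \<Longrightarrow> X + Y \<in> A" "X \<in> A \<Longrightarrow> Y \<in> A \<Longrightarrow> X - Y \<in> A"
    "X \<in> A \<Longrightarrow> c *\<^sub>M X \<in> A" "X \<in> A \<Longrightarrow> Y \<in> A \<Longrightarrow> X ** Y \<in> A"
  using assms by (auto simp: subalgebra_def matsp.subspace_add matsp.subspace_diff matsp.subspace_scale)

text \<open>
  Here \<open>N\<close> generates \<open>\<complex>[x] / x (x - q) (x - r)\<close> with three distinct roots, and \<open>a\<close> and \<open>b\<close>
  are the Lagrange idempotents at \<open>q\<close> and at \<open>r\<close>.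
\<close>

lemma has_normal_basis_distinct_roots:
  assumes A: "subalgebra A" "N \<in> A" and i: "independent_3 (mat 1) N (N ** N)"
    and N: "N ** (N ** N) = (q + r) *\<^sub>M (N ** N) - (q * r) *\<^sub>M N"
    and d: "q \<noteq> 0" "r \<noteq> 0" "q \<noteq> r"
  shows "has_normal_basis A"
proof -
  define Y where "Y = N ** N"
  have NY: "N ** Y = (q + r) *\<^sub>M Y - (q * r) *\<^sub>M N" using N by (simp only: Y_def)
  have YN: "Y ** N = (q + r) *\<^sub>M Y - (q * r) *\<^sub>M N" using N by (simp only: Y_def matrix_mul_assoc)
  have "Y ** Y = N ** (N ** Y)" by (simp add: Y_def matrix_mul_assoc)
  also have "\<dots> = N ** ((q + r) *\<^sub>M Y - (q * r) *\<^sub>M N)" by (simp only: NY)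
  also have "\<dots> = (q + r) *\<^sub>M (N ** Y) - (q * r) *\<^sub>M Y"
    by (simp add: matrix_ring_simps Y_def)
  finally have YY: "Y ** Y = ((q + r)^2 - q * r) *\<^sub>M Y - ((q + r) * q * r) *\<^sub>M N"
    unfolding NY by (simp add: entrywise algebra_simps power2_eq_square)
  define a where "a = (1 / (q * (q - r))) *\<^sub>M (Y - r *\<^sub>M N)"
  define b where "b = (1 / (r * (r - q))) *\<^sub>M (Y - q *\<^sub>M N)"
  have nz: "q - r \<noteq> 0" "r - q \<noteq> 0" using d by auto
  have e1: "(Y - r *\<^sub>M N) ** (Y - r *\<^sub>M N) = (q * (q - r)) *\<^sub>M (Y - r *\<^sub>M N)"
    by (simp add: matrix_ring_simps YY NY YN Y_def[symmetric])
       (simp add: entrywise algebra_simps power2_eq_square)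
  have e2: "(Y - q *\<^sub>M N) ** (Y - q *\<^sub>M N) = (r * (r - q)) *\<^sub>M (Y - q *\<^sub>M N)"
    by (simp add: matrix_ring_simps YY NY YN Y_def[symmetric])
       (simp add: entrywise algebra_simps power2_eq_square)
  have e3: "(Y - r *\<^sub>M N) ** (Y - q *\<^sub>M N) = 0" "(Y - q *\<^sub>M N) ** (Y - r *\<^sub>M N) = 0"
    by (simp_all add: matrix_ring_simps YY NY YN Y_def[symmetric])
       (simp_all add: entrywise algebra_simps power2_eq_square)
  have "a ** a = a" "b ** b = b" "a ** b = 0" "b ** a = 0"
    using d nz by (simp_all add: a_def b_def mat_scale_mult_left mat_scale_mult_right e1 e2 e3)
  then have "normal_table a b" by (simp add: normal_table_def)
  moreover have "independent_3 (mat 1) a b"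
  proof (rule independent_3_change[OF i])
    show "a = 0 *\<^sub>M mat 1 + (- r / (q * (q - r))) *\<^sub>M N + (1 / (q * (q - r))) *\<^sub>M (N ** N)"
      by (simp add: a_def Y_def entrywise algebra_simps diff_divide_distrib)
    show "b = 0 *\<^sub>M mat 1 + (- q / (r * (r - q))) *\<^sub>M N + (1 / (r * (r - q))) *\<^sub>M (N ** N)"
      by (simp add: b_def Y_def entrywise algebra_simps diff_divide_distrib)
    have "(- r / (q * (q - r))) * (1 / (r * (r - q))) - (1 / (q * (q - r))) * (- q / (r * (r - q)))
        = (q - r) / (q * (q - r) * (r * (r - q)))"
      by (simp add: diff_divide_distrib)
    also have "\<dots> \<noteq> 0" using d nz by simp
    finally show "(- r / (q * (q - r))) * (1 / (r * (r - q))) - (1 / (q * (q - r))) * (- q / (r * (r - q))) \<noteq> 0" .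
  qed
  moreover have "a \<in> A" "b \<in> A"
    using A by (auto simp: a_def b_def Y_def intro!: subalgebraD)
  ultimately show ?thesis by (auto simp: has_normal_basis_def)
qed

text \<open>
  Here \<open>N\<close> generates \<open>\<complex>[x] / x\<^sup>2 (x - r)\<close>. For \<open>r = 0\<close> this is a truncated polynomial
  ring. Otherwise the Chinese remainder theorem splits it, with the idempotent \<open>N\<^sup>2 / r\<^sup>2\<close>
  belonging to the root \<open>r\<close> and the nilpotent \<open>N (N - r)\<close> to the root 0.
\<close>

lemma has_normal_basis_double_root:
  assumes A: "subalgebra A" "N \<in> A" and i: "independent_3 (mat 1) N (N ** N)"
    and N: "N ** (N ** N) = r *\<^sub>M (N ** N)"
  shows "has_normal_basis A"
proof -
  define Y where "Y = N ** N"
  have NY: "N ** Y = r *\<^sub>M Y" using N by (simp only: Y_def)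
  have YN: "Y ** N = r *\<^sub>M Y" using N by (simp only: Y_def matrix_mul_assoc)
  have "Y ** Y = N ** (N ** Y)" by (simp add: Y_def matrix_mul_assoc)
  also have "\<dots> = (r * r) *\<^sub>M Y"
    by (simp add: NY matrix_ring_simps)
  finally have YY: "Y ** Y = (r * r) *\<^sub>M Y" .
  show ?thesis
  proof (cases "r = 0")
    case True
    have "normal_table Y N"
      using NY YN YY True by (simp add: normal_table_def Y_def[symmetric])
    moreover have "independent_3 (mat 1) Y N"
      by (rule independent_3_change[OF i, where ?a0.0 = 0 and ?a1.0 = 0 and ?a2.0 = 1
            and ?b0.0 = 0 and ?b1.0 = 1 and ?b2.0 = 0]) (simp_all add: Y_def)
    ultimately show ?thesis
      using A by (auto simp: has_normal_basis_def Y_def intro!: subalgebraD)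
  next
    case False
    define a where "a = (1 / (r * r)) *\<^sub>M Y"
    define b where "b = Y - r *\<^sub>M N"
    have "a ** a = a" "b ** b = 0" "a ** b = 0" "b ** a = 0"
      using False
      by (simp_all add: a_def b_def matrix_ring_simps YY NY YN Y_def[symmetric])
    then have "normal_table a b" by (simp add: normal_table_def)
    moreover have "independent_3 (mat 1) a b"
      by (rule independent_3_change[OF i, where ?a0.0 = 0 and ?a1.0 = 0 and ?a2.0 = "1 / (r * r)"
            and ?b0.0 = 0 and ?b1.0 = "- r" and ?b2.0 = 1])
         (use False in \<open>simp_all add: a_def b_def Y_def\<close>)
    moreover have "a \<in> A" "b \<in> A"
      using A by (auto simp: a_def b_def Y_def intro!: subalgebraD)
    ultimately show ?thesis by (auto simp: has_normal_basis_def)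
  qed
qed

text \<open>
  Translating \<open>X\<close> by a root of its cubic, chosen to be a multiple root if there is one,
  reduces to the two lemmas above.
\<close>

lemma has_normal_basis_cyclic:
  assumes A: "subalgebra A" "mat 1 \<in> A" "X \<in> A" and i: "independent_3 (mat 1) X (X ** X)"
    and X: "X ** (X ** X) = c0 *\<^sub>M mat 1 + c1 *\<^sub>M X + c2 *\<^sub>M (X ** X)"
  shows "has_normal_basis A"
proof -
  have shift: "X - p *\<^sub>M mat 1 \<in> A"
     "independent_3 (mat 1) (X - p *\<^sub>M mat 1) ((X - p *\<^sub>M mat 1) ** (X - p *\<^sub>M mat 1))" 
     "(X - p *\<^sub>M mat 1) ** ((X - p *\<^sub>M mat 1) ** (X - p *\<^sub>M mat 1)) =
       ((q - p) + (r - p)) *\<^sub>M ((X - p *\<^sub>M mat 1) ** (X - p *\<^sub>M mat 1))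
       - ((q - p) * (r - p)) *\<^sub>M (X - p *\<^sub>M mat 1)"
    if c: "c2 = p + q + r" "c1 = - (p * q + p * r + q * r)" "c0 = p * q * r" for p q r
  proof -
    show "X - p *\<^sub>M mat 1 \<in> A" using A by (simp add: subalgebraD)
    show "independent_3 (mat 1) (X - p *\<^sub>M mat 1) ((X - p *\<^sub>M mat 1) ** (X - p *\<^sub>M mat 1))"
      by (rule independent_3_change[OF i, where ?a0.0 = "- p" and ?a1.0 = 1 and ?a2.0 = 0
            and ?b0.0 = "p * p" and ?b1.0 = "- 2 * p" and ?b2.0 = 1])
         (simp_all add: matrix_ring_simps, simp_all add: entrywise algebra_simps)
    show "(X - p *\<^sub>M mat 1) ** ((X - p *\<^sub>M mat 1) ** (X - p *\<^sub>M mat 1)) =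
       ((q - p) + (r - p)) *\<^sub>M ((X - p *\<^sub>M mat 1) ** (X - p *\<^sub>M mat 1))
       - ((q - p) * (r - p)) *\<^sub>M (X - p *\<^sub>M mat 1)"
      by (simp add: matrix_ring_simps X c) (simp add: entrywise algebra_simps)
  qed
  obtain p q r where c: "c2 = p + q + r" "c1 = - (p * q + p * r + q * r)" "c0 = p * q * r"
    using monic_cubic_splits .
  have double: "has_normal_basis A"
    if "c2 = p + p + r" "c1 = - (p * p + p * r + p * r)" "c0 = p * p * r" for p r
    by (rule has_normal_basis_double_root[OF A(1) shift(1,2)[OF that], where r = "r - p"])
       (use shift(3)[OF that] in simp)
  consider "p \<noteq> q \<and> p \<noteq> r \<and> q \<noteq> r" | "p = q" | "p = r" | "q = r" by blast
  then show ?thesis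
  proof cases
    case 1
    then show ?thesis
      by (intro has_normal_basis_distinct_roots[OF A(1) shift[OF c]]) auto
  next
    case 2 then show ?thesis using double[of p r] c by simp
  next
    case 3 then show ?thesis using double[of p q] c by (simp add: algebra_simps)
  next
    case 4 then show ?thesis using double[of q p] c by (simp add: algebra_simps)
  qed
qed

text \<open>
  Since \<open>n (n m) = 0\<close>, the product \<open>n m\<close> is a multiple \<open>y n\<close> of \<open>n\<close>. Then \<open>(m n) n = 0\<close>
  gives \<open>\<nu> = 0\<close>, so \<open>m n = - y n\<close>, and \<open>n m\<^sup>2\<close> computed in two ways gives \<open>\<mu> = y\<^sup>2\<close>. If
  \<open>y = 0\<close> all products vanish. If not, \<open>m / y\<close> is an involution, and \<open>(1 - m / y) / 2\<close> is
  the idempotent of a triangular algebra with nilpotent element \<open>n\<close>.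
\<close>

lemma has_normal_basis_null_square:
  assumes A: "subalgebra A" "mat 1 \<in> A" "n \<in> A" "m \<in> A" and i: "independent_3 (mat 1) n m"
    and span: "A = matsp.span {mat 1, n, m}"
    and nn: "n ** n = 0" and mm: "m ** m = \<mu> *\<^sub>M mat 1" and nm: "n ** m + m ** n = \<nu> *\<^sub>M mat 1"
  shows "has_normal_basis A"
proof -
  have "n ** m \<in> A" using A by (simp add: subalgebraD)
  then obtain x y z where xyz: "n ** m = x *\<^sub>M mat 1 + y *\<^sub>M n + z *\<^sub>M m"
    unfolding span mem_span_3 by blast
  have "0 = n ** (n ** m)" by (simp add: matrix_mul_assoc nn matrix_mult_zero)
  also have "\<dots> = x *\<^sub>M n + z *\<^sub>M (n ** m)" 
    by (subst xyz) (simp add: matrix_ring_simps nn)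
  finally have "(z * x) *\<^sub>M mat 1 + (x + z * y) *\<^sub>M n + (z * z) *\<^sub>M m = 0"
    unfolding xyz by (simp add: entrywise algebra_simps)
  note z = independent_3D[OF i this]
  have nm': "n ** m = y *\<^sub>M n" using xyz z(2,3) by simp
  then have mn: "m ** n = \<nu> *\<^sub>M mat 1 - y *\<^sub>M n" using nm by (metis add_diff_cancel_left')
  have "0 = m ** n ** n" by (simp add: matrix_mul_assoc[symmetric] nn matrix_mult_zero)
  also have "\<dots> = \<nu> *\<^sub>M n" unfolding mn by (simp add: matrix_ring_simps nn)
  finally have "0 *\<^sub>M mat 1 + \<nu> *\<^sub>M n + 0 *\<^sub>M m = 0" by simp
  then have \<nu>: "\<nu> = 0" by (rule independent_3D(2)[OF i])
  have mn': "m ** n = (- y) *\<^sub>M n" using mn \<nu> by simp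
  have "\<mu> *\<^sub>M n = n ** m ** m" by (simp add: matrix_mul_assoc[symmetric] mm matrix_ring_simps)
  also have "\<dots> = (y * y) *\<^sub>M n" by (simp add: nm' matrix_ring_simps)
  finally have "0 *\<^sub>M mat 1 + (\<mu> - y * y) *\<^sub>M n + 0 *\<^sub>M m = 0"
    by (simp add: entrywise algebra_simps)
  then have "\<mu> - y * y = 0" by (rule independent_3D(2)[OF i])
  then have \<mu>: "\<mu> = y * y" by simp
  show ?thesis
  proof (cases "y = 0")
    case True
    then have "normal_table n m" using nn mm nm' mn' \<mu> by (simp add: normal_table_def)
    then show ?thesis using A i by (auto simp: has_normal_basis_def)
  next
    case False
    define a where "a = (1 / 2) *\<^sub>M mat 1 - (1 / (2 * y)) *\<^sub>M m"
    have "a ** a = a"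
      using False by (simp add: a_def matrix_ring_simps mm \<mu>) (simp add: entrywise field_simps)
    moreover have "a ** n = n"
      using False by (simp add: a_def matrix_ring_simps mn') (simp add: entrywise field_simps)
    moreover have "n ** a = 0"
      using False by (simp add: a_def matrix_ring_simps nm')
    ultimately have "normal_table a n" using nn by (simp add: normal_table_def)
    moreover have "independent_3 (mat 1) a n"
      by (rule independent_3_change[OF i, where ?a0.0 = "1/2" and ?a1.0 = 0 and ?a2.0 = "- 1 / (2 * y)"
            and ?b0.0 = 0 and ?b1.0 = 1 and ?b2.0 = 0])
         (use False in \<open>simp_all add: a_def\<close>)
    moreover have "a \<in> A" using A by (simp add: a_def subalgebraD)
    ultimately show ?thesis using A by (auto simp: has_normal_basis_def)
  qed
qed

lemma scalar_square_shift:
  fixes X :: "complex ^ 3 ^ 3"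
  assumes "X ** X = p *\<^sub>M mat 1 + q *\<^sub>M X"
  shows "(X - (q / 2) *\<^sub>M mat 1) ** (X - (q / 2) *\<^sub>M mat 1) = (p + q * q / 4) *\<^sub>M mat 1"
  by (simp add: matrix_ring_simps assms) (simp add: entrywise field_simps)

text \<open>
  After completing squares, \<open>c\<close> and \<open>d\<close> have scalar squares. Comparing \<open>(c + d)\<^sup>2\<close> with
  \<open>(c - d)\<^sup>2\<close> shows that \<open>c d + d c\<close> is a scalar too, so squaring is a quadratic form on
  the span of \<open>c\<close> and \<open>d\<close>. Over the complex numbers it has a nonzero isotropic vector \<open>n\<close>.
\<close>

lemma has_normal_basis_quadratic:
  assumes A: "subalgebra A" "mat 1 \<in> A" "matsp.dim A = 3"
    and a: "a \<in> A" "b \<in> A" "independent_3 (mat 1) a b"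
    and quad: "\<And>X. X \<in> A \<Longrightarrow> \<exists>p q. X ** X = p *\<^sub>M mat 1 + q *\<^sub>M X"
  shows "has_normal_basis A"
proof -
  obtain p q p' q' where aa: "a ** a = p *\<^sub>M mat 1 + q *\<^sub>M a" and bb: "b ** b = p' *\<^sub>M mat 1 + q' *\<^sub>M b"
    using quad a by metis
  define c where "c = a - (q / 2) *\<^sub>M mat 1"
  define d where "d = b - (q' / 2) *\<^sub>M mat 1"
  obtain \<alpha> \<beta> where cc: "c ** c = \<alpha> *\<^sub>M mat 1" and dd: "d ** d = \<beta> *\<^sub>M mat 1"
    using scalar_square_shift[OF aa] scalar_square_shift[OF bb] unfolding c_def d_def by blast
  have cdA: "c \<in> A" "d \<in> A" using A a by (auto simp: c_def d_def subalgebraD)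
  have i: "independent_3 (mat 1) c d"
    by (rule independent_3_change[OF a(3), where ?a0.0 = "- q / 2" and ?a1.0 = 1 and ?a2.0 = 0
          and ?b0.0 = "- q' / 2" and ?b1.0 = 0 and ?b2.0 = 1])
       (simp_all add: c_def d_def)
  obtain r s r' s' where r: "(c + d) ** (c + d) = r *\<^sub>M mat 1 + s *\<^sub>M (c + d)"
    and r': "(c - d) ** (c - d) = r' *\<^sub>M mat 1 + s' *\<^sub>M (c - d)"
    using quad[of "c + d"] quad[of "c - d"] cdA A(1) subalgebraD(1,2) by metis
  have cd: "c ** d + d ** c = (r - \<alpha> - \<beta>) *\<^sub>M mat 1 + s *\<^sub>M (c + d)"
    using r by (simp add: matrix_ring_simps cc dd) (simp add: entrywise algebra_simps)
  have "- (c ** d + d ** c) = (r' - \<alpha> - \<beta>) *\<^sub>M mat 1 + s' *\<^sub>M (c - d)"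
    using r' by (simp add: matrix_ring_simps cc dd) (simp add: entrywise algebra_simps)
  then have "(r + r' - 2 * \<alpha> - 2 * \<beta>) *\<^sub>M mat 1 + (s + s') *\<^sub>M c + (s - s') *\<^sub>M d = 0"
    unfolding cd by (simp add: entrywise algebra_simps)
  then have "s + s' = 0" "s - s' = 0" using independent_3D[OF i] by blast+
  then have "s = 0" by algebra
  with cd obtain \<gamma> where cd: "c ** d + d ** c = \<gamma> *\<^sub>M mat 1" by auto
  show ?thesis
  proof (cases "\<beta> = 0")
    case True
    have j: "independent_3 (mat 1) d c"
      by (rule independent_3_change[OF i, where ?a0.0 = 0 and ?a1.0 = 0 and ?a2.0 = 1
            and ?b0.0 = 0 and ?b1.0 = 1 and ?b2.0 = 0]) simp_all
    show ?thesis
    proof (rule has_normal_basis_null_square[OF A(1,2) cdA(2,1) j])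
      show "A = matsp.span {mat 1, d, c}"
        using span_of_independent_3[of A] A cdA j by (auto simp: subalgebra_def)
      show "d ** d = 0" using dd True by simp
      show "c ** c = \<alpha> *\<^sub>M mat 1" by (rule cc)
      show "d ** c + c ** d = \<gamma> *\<^sub>M mat 1" using cd by (simp add: add.commute)
    qed
  next
    case False
    then have "\<not> constant (poly [:\<alpha>, \<gamma>, \<beta>:])" by (simp add: constant_degree)
    then obtain t where t: "poly [:\<alpha>, \<gamma>, \<beta>:] t = 0"
      using fundamental_theorem_of_algebra by blast
    define n where "n = c + t *\<^sub>M d"
    have j: "independent_3 (mat 1) n d"
      by (rule independent_3_change[OF i, where ?a0.0 = 0 and ?a1.0 = 1 and ?a2.0 = t
            and ?b0.0 = 0 and ?b1.0 = 0 and ?b2.0 = 1]) (simp_all add: n_def)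
    have nA: "n \<in> A" using A cdA by (simp add: n_def subalgebraD)
    show ?thesis
    proof (rule has_normal_basis_null_square[OF A(1,2) nA cdA(2) j])
      show "A = matsp.span {mat 1, n, d}"
        using span_of_independent_3[of A] A cdA nA j by (auto simp: subalgebra_def)
      have "n ** n = \<alpha> *\<^sub>M mat 1 + t *\<^sub>M (c ** d + d ** c) + (t * t * \<beta>) *\<^sub>M mat 1"
        by (simp add: n_def matrix_ring_simps cc dd) (simp add: entrywise algebra_simps)
      also have "\<dots> = (poly [:\<alpha>, \<gamma>, \<beta>:] t) *\<^sub>M mat 1"
        unfolding cd by (simp add: entrywise algebra_simps)
      finally show "n ** n = 0" using t by simp
      show "d ** d = \<beta> *\<^sub>M mat 1" by (rule dd)
      have "n ** d + d ** n = (c ** d + d ** c) + (2 * t * \<beta>) *\<^sub>M mat 1"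
        by (simp add: n_def matrix_ring_simps dd) (simp add: entrywise algebra_simps)
      also have "\<dots> = (\<gamma> + 2 * t * \<beta>) *\<^sub>M mat 1" unfolding cd by (simp add: entrywise algebra_simps)
      finally show "n ** d + d ** n = (\<gamma> + 2 * t * \<beta>) *\<^sub>M mat 1" .
    qed
  qed
qed

text \<open>
  Either some \<open>X\<close> is cyclic, or each \<open>X\<close> satisfies a quadratic equation: a dependency
  between \<open>E\<close>, \<open>X\<close> and \<open>X\<^sup>2\<close> without a quadratic term makes \<open>X\<close> a scalar, whose square is
  again a scalar.
\<close>

lemma unital_3dim_has_normal_basis:
  assumes A: "subalgebra A" "mat 1 \<in> A" "matsp.dim A = 3"
  shows "has_normal_basis A"
proof (cases "\<exists>X\<in>A. independent_3 (mat 1) X (X ** X)")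
  case True
  then obtain X where X: "X \<in> A" and i: "independent_3 (mat 1) X (X ** X)" by blast
  have XX: "X ** X \<in> A" "X ** (X ** X) \<in> A" using A X by (simp_all add: subalgebraD)
  have "A = matsp.span {mat 1, X, X ** X}"
    using span_of_independent_3[of A] A X XX i by (auto simp: subalgebra_def)
  then obtain c0 c1 c2 where "X ** (X ** X) = c0 *\<^sub>M mat 1 + c1 *\<^sub>M X + c2 *\<^sub>M (X ** X)"
    using XX(2) mem_span_3 by blast
  then show ?thesis using has_normal_basis_cyclic[OF A(1,2) X i] by blast
next
  case False
  have quad: "\<exists>p q. X ** X = p *\<^sub>M mat 1 + q *\<^sub>M X" if X: "X \<in> A" for X
  proof -
    obtain x y z where e: "x *\<^sub>M mat 1 + y *\<^sub>M X + z *\<^sub>M (X ** X) = 0" and nz: "\<not> (x = 0 \<and> y = 0 \<and> z = 0)"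
      using False X unfolding independent_3_def by blast
    show ?thesis
    proof (cases "z = 0")
      case True
      have "y \<noteq> 0"
      proof
        assume "y = 0"
        then have "x *\<^sub>M (mat 1 :: complex ^ 3 ^ 3) = 0" using e True by simp
        then have "x = 0" by (auto simp: entrywise mat_def forall_3)
        then show False using nz True \<open>y = 0\<close> by simp
      qed
      have "X = (1 / y) *\<^sub>M (y *\<^sub>M X)" using \<open>y \<noteq> 0\<close> by simp
      also have "y *\<^sub>M X = - (x *\<^sub>M mat 1)" using e True by (simp add: eq_neg_iff_add_eq_0 add.commute)
      finally have X': "X = (- x / y) *\<^sub>M mat 1" by simp
      have "X ** X = ((- x / y) * (- x / y)) *\<^sub>M mat 1 + 0 *\<^sub>M X"
        by (subst (1 2) X') (simp add: matrix_ring_simps)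
      then show ?thesis by blast
    next
      case z: False
      have "X ** X = (1 / z) *\<^sub>M (z *\<^sub>M (X ** X))" using z by simp
      also have "z *\<^sub>M (X ** X) = - (x *\<^sub>M mat 1 + y *\<^sub>M X)"
        using e by (metis eq_neg_iff_add_eq_0 add.commute)
      finally have "X ** X = (- x / z) *\<^sub>M mat 1 + (- y / z) *\<^sub>M X"
        by (simp add: matsp.scale_right_distrib matsp.scale_right_diff_distrib)
      then show ?thesis by blast
    qed
  qed
  have "\<not> matsp.dependent {mat 1 :: complex ^ 3 ^ 3}"
    by (simp add: matsp.dependent_single entrywise mat_def forall_3)
  then obtain T where T: "{mat 1} \<subseteq> T" "T \<subseteq> A" "\<not> matsp.dependent T" "A \<subseteq> matsp.span T"
    using matsp.maximal_independent_subset_extend[of "{mat 1}" A] A(2) by blast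
  have "card T = 3" using matsp.basis_card_eq_dim[OF T(2,4,3)] A(3) by simp
  then obtain u v w where uvw: "T = {u, v, w}" "u \<noteq> v" "u \<noteq> w" "v \<noteq> w"
    by (auto simp: card_3_iff)
  obtain a b where ab: "T = {mat 1, a, b}" "mat 1 \<noteq> a" "mat 1 \<noteq> b" "a \<noteq> b"
  proof -
    have "mat 1 = u \<or> mat 1 = v \<or> mat 1 = w" using T(1) uvw(1) by blast
    then show ?thesis
      using that[of v w] that[of u w] that[of u v] uvw by (elim disjE) (simp_all add: insert_commute)
  qed
  have "independent_3 (mat 1) a b" using ab T(3) by (simp add: independent_3_iff)
  then show ?thesis
    using has_normal_basis_quadratic[OF A, of a b] quad T(2) ab(1) by blast
qed

section \<open>Vectors, rank-one matrices and frames\<close>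

lemma mat_scale_mult_vec: "(c *\<^sub>M X) *v y = c *s (X *v y)" for X :: "'a::field ^ 'n ^ 'm"
  by (simp add: mat_scale_def matrix_vector_mult_def vec_eq_iff sum_distrib_left mult.assoc)

text \<open>
  There is no conjugation: \<open>dot w\<close> ranges over all linear functionals, and its kernel is
  what orthogonality to \<open>w\<close> refers to.
\<close>

definition dot :: "'a::field ^ 3 \<Rightarrow> 'a ^ 3 \<Rightarrow> 'a"
  where "dot w y = w $ 1 * y $ 1 + w $ 2 * y $ 2 + w $ 3 * y $ 3"

definition cross :: "'a::field ^ 3 \<Rightarrow> 'a ^ 3 \<Rightarrow> 'a ^ 3"
  where "cross x y = vector [x $ 2 * y $ 3 - x $ 3 * y $ 2, x $ 3 * y $ 1 - x $ 1 * y $ 3,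
    x $ 1 * y $ 2 - x $ 2 * y $ 1]"

definition outer :: "'a::field ^ 3 \<Rightarrow> 'a ^ 3 \<Rightarrow> 'a ^ 3 ^ 3"
  where "outer z w = (\<chi> i j. z $ i * w $ j)"

definition column_matrix :: "3 \<Rightarrow> 'a::field ^ 3 \<Rightarrow> 'a ^ 3 ^ 3"
  where "column_matrix j y = (\<chi> i k. if k = j then y $ i else 0)"

lemma vec_nonzero_iff: "u \<noteq> 0 \<longleftrightarrow> (\<exists>k. u $ k \<noteq> 0)" for u :: "'a::zero ^ 'n"
  by (simp add: vec_eq_iff)

lemma dot_eq_1:
  assumes "u \<noteq> 0"
  obtains y where "dot u y = 1"
proof -
  obtain k where k: "u $ k \<noteq> 0" using assms vec_nonzero_iff by blast
  then have "dot u (axis k (1 / u $ k)) = 1"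
    using exhaust_3[of k] by (auto simp: dot_def axis_def)
  then show ?thesis by (rule that)
qed

lemma cross_eq_0_imp_parallel:
  assumes "u \<noteq> 0" "cross u y = 0"
  shows "\<exists>k. y = k *s u"
proof -
  obtain k where k: "u $ k \<noteq> 0" using assms vec_nonzero_iff by blast
  have "u $ k * y $ i = u $ i * y $ k" for i
    using assms(2) exhaust_3[of k] exhaust_3[of i]
    by (auto simp: cross_def vec_eq_iff forall_3 algebra_simps)
  then have "y $ i = (y $ k / u $ k) * u $ i" for i
    using k by (simp add: field_simps)
  then show ?thesis by (metis vec_eq_iff vector_smult_component)
qed

lemma cross_cross: "cross (cross w v) y = dot w y *s v - dot v y *s w"
  by (simp add: cross_def dot_def vec_eq_iff forall_3 algebra_simps)

lemma dot_cross_self [simp]: "dot w (cross w v) = 0" "dot v (cross w v) = 0" "dot (cross w v) w = 0"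
  by (simp_all add: dot_def cross_def algebra_simps)

lemma dot_cross_cross: "dot (cross u x) (cross w y) = dot u w * dot x y - dot u y * dot x w"
  by (simp add: dot_def cross_def algebra_simps)

lemma dot_commute: "dot x y = dot y x"
  by (simp add: dot_def mult.commute)

lemma dot_scale: "dot (k *s w) y = k * dot w y"
  by (simp add: dot_def algebra_simps)

lemma outer_mult_vec: "outer z w *v y = dot w y *s z"
  by (simp add: outer_def matrix_vector_mult_def dot_def vec_eq_iff sum_3 algebra_simps)

lemma outer_mult_outer: "outer z w ** outer z' w' = dot w z' *\<^sub>M outer z w'"
  by (simp add: outer_def matrix_matrix_mult_def dot_def entrywise sum_3 algebra_simps)

lemma sum_outer_rows: "X = outer (axis 1 1) (X $ 1) + outer (axis 2 1) (X $ 2) + outer (axis 3 1) (X $ 3)"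
  by (simp add: outer_def vec_eq_iff axis_def forall_3)

lemma row_dot: "dot (X $ i) u = (X *v u) $ i"
  by (simp add: dot_def matrix_vector_mult_def sum_3)

lemma mult_column_matrix: "X ** column_matrix j y = column_matrix j (X *v y)"
  by (simp add: column_matrix_def matrix_matrix_mult_def matrix_vector_mult_def vec_eq_iff sum_3)

lemma column_matrix_mult_vec: "column_matrix j y *v u = u $ j *s y"
  using exhaust_3[of j]
  by (auto simp: column_matrix_def matrix_vector_mult_def vec_eq_iff sum_3)

lemma sum_columns: "X = column_matrix 1 (column 1 X) + column_matrix 2 (column 2 X) + column_matrix 3 (column 3 X)"
  by (simp add: column_matrix_def column_def vec_eq_iff forall_3)

lemma column_matrix_expand:
  "column_matrix j y = y $ 1 *\<^sub>M column_matrix j (axis 1 1) + y $ 2 *\<^sub>M column_matrix j (axis 2 1)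
    + y $ 3 *\<^sub>M column_matrix j (axis 3 1)"
  by (simp add: column_matrix_def entrywise axis_def forall_3)

lemma invertible_mult_vec_eq_0:
  fixes G :: "'a::field ^ 'n ^ 'n"
  assumes "invertible G" "G *v t = 0"
  shows "t = 0"
proof -
  obtain H where "H ** G = mat 1" using assms(1) unfolding invertible_def by blast
  then have "t = H *v (G *v t)" by (simp add: matrix_vector_mul_assoc)
  then show ?thesis using assms(2) by simp
qed

definition frame_matrix :: "'a::field ^ 3 \<Rightarrow> 'a ^ 3 \<Rightarrow> 'a ^ 3 \<Rightarrow> 'a ^ 3 ^ 3"
  where "frame_matrix u v w = transpose (vector [u, v, w])"

lemma frame_matrix_mult_vec: "frame_matrix u v w *v t = t $ 1 *s u + t $ 2 *s v + t $ 3 *s w"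
  by (simp add: frame_matrix_def transpose_def matrix_vector_mult_def vec_eq_iff sum_3 algebra_simps)

section \<open>Subalgebras of codimension 3 that do not contain the identity\<close>

text \<open>
  The hypotheses express that the identity, \<open>a\<close> and \<open>b\<close> form a basis of a complement of
  \<open>B\<close>. In this form they pass directly to the transposes.
\<close>

locale complement_basis =
  fixes B :: "(complex ^ 3 ^ 3) set" and a b :: "complex ^ 3 ^ 3"
  assumes subalg: "subalgebra B"
    and decompose: "\<exists>x y z. X - (x *\<^sub>M mat 1 + y *\<^sub>M a + z *\<^sub>M b) \<in> B"
    and unique: "x *\<^sub>M mat 1 + y *\<^sub>M a + z *\<^sub>M b \<in> B \<Longrightarrow> x = 0 \<and> y = 0 \<and> z = 0"
begin

definition coords :: "complex ^ 3 ^ 3 \<Rightarrow> complex ^ 3"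
  where "coords X = (SOME t. X - (t $ 1 *\<^sub>M mat 1 + t $ 2 *\<^sub>M a + t $ 3 *\<^sub>M b) \<in> B)"

lemma coords_decompose:
  "X - (coords X $ 1 *\<^sub>M mat 1 + coords X $ 2 *\<^sub>M a + coords X $ 3 *\<^sub>M b) \<in> B"
proof -
  obtain x y z where "X - (x *\<^sub>M mat 1 + y *\<^sub>M a + z *\<^sub>M b) \<in> B" using decompose by blast
  then have "X - ((vector [x, y, z] :: complex ^ 3) $ 1 *\<^sub>M mat 1
    + (vector [x, y, z] :: complex ^ 3) $ 2 *\<^sub>M a + (vector [x, y, z] :: complex ^ 3) $ 3 *\<^sub>M b) \<in> B"
    by simp
  then show ?thesis unfolding coords_def by (rule someI)
qed

lemma coords_eqI:
  assumes "X - (x *\<^sub>M mat 1 + y *\<^sub>M a + z *\<^sub>M b) \<in> B"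
  shows "coords X = vector [x, y, z]"
proof -
  have "(X - (x *\<^sub>M mat 1 + y *\<^sub>M a + z *\<^sub>M b))
    - (X - (coords X $ 1 *\<^sub>M mat 1 + coords X $ 2 *\<^sub>M a + coords X $ 3 *\<^sub>M b)) \<in> B"
    using subalgebraD(2)[OF subalg assms coords_decompose] .
  also have "(X - (x *\<^sub>M mat 1 + y *\<^sub>M a + z *\<^sub>M b))
    - (X - (coords X $ 1 *\<^sub>M mat 1 + coords X $ 2 *\<^sub>M a + coords X $ 3 *\<^sub>M b))
    = (coords X $ 1 - x) *\<^sub>M mat 1 + (coords X $ 2 - y) *\<^sub>M a + (coords X $ 3 - z) *\<^sub>M b"
    by (simp add: entrywise algebra_simps)
  finally have "coords X $ 1 - x = 0 \<and> coords X $ 2 - y = 0 \<and> coords X $ 3 - z = 0"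
    by (rule unique)
  then show ?thesis by (simp add: vec_eq_iff forall_3)
qed

lemma coords_add: "coords (X + Y) = coords X + coords Y"
proof -
  have "(X + Y) - ((coords X $ 1 + coords Y $ 1) *\<^sub>M mat 1 + (coords X $ 2 + coords Y $ 2) *\<^sub>M a
    + (coords X $ 3 + coords Y $ 3) *\<^sub>M b)
    = (X - (coords X $ 1 *\<^sub>M mat 1 + coords X $ 2 *\<^sub>M a + coords X $ 3 *\<^sub>M b))
     + (Y - (coords Y $ 1 *\<^sub>M mat 1 + coords Y $ 2 *\<^sub>M a + coords Y $ 3 *\<^sub>M b))"
    by (simp add: entrywise algebra_simps)
  also have "\<dots> \<in> B" by (rule subalgebraD(1)[OF subalg coords_decompose coords_decompose])
  finally show ?thesis by (subst coords_eqI) (auto simp: vec_eq_iff forall_3)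
qed

lemma coords_scale: "coords (k *\<^sub>M X) = k *s coords X"
proof -
  have "k *\<^sub>M X - ((k * coords X $ 1) *\<^sub>M mat 1 + (k * coords X $ 2) *\<^sub>M a + (k * coords X $ 3) *\<^sub>M b)
    = k *\<^sub>M (X - (coords X $ 1 *\<^sub>M mat 1 + coords X $ 2 *\<^sub>M a + coords X $ 3 *\<^sub>M b))"
    by (simp add: entrywise algebra_simps)
  also have "\<dots> \<in> B" by (rule subalgebraD(3)[OF subalg coords_decompose])
  finally show ?thesis by (subst coords_eqI) (auto simp: vec_eq_iff forall_3)
qed

lemma coords_mem: "X \<in> B \<Longrightarrow> coords X = 0"
  by (subst coords_eqI[of X 0 0 0]) (simp_all add: vec_eq_iff forall_3)

lemma coords_a: "coords a = vector [0, 1, 0]"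
  using subalg by (intro coords_eqI) (simp add: subalgebra_def matsp.subspace_0)

text \<open>
  The component of \<open>Y\<close> along the identity contributes a multiple of \<open>X \<in> B\<close>, and the
  component in \<open>B\<close> contributes an element of \<open>B\<close>.
\<close>

lemma coords_mult_left:
  assumes "X \<in> B"
  shows "coords (X ** Y) = coords Y $ 2 *s coords (X ** a) + coords Y $ 3 *s coords (X ** b)"
proof -
  define Z where "Z = Y - (coords Y $ 1 *\<^sub>M mat 1 + coords Y $ 2 *\<^sub>M a + coords Y $ 3 *\<^sub>M b)"
  have "X ** Y = X ** (coords Y $ 1 *\<^sub>M mat 1 + coords Y $ 2 *\<^sub>M a + coords Y $ 3 *\<^sub>M b + Z)"
    by (simp add: Z_def)
  also have "\<dots> = coords Y $ 1 *\<^sub>M X + coords Y $ 2 *\<^sub>M (X ** a) + coords Y $ 3 *\<^sub>M (X ** b) + X ** Z"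
    by (simp add: matrix_ring_simps)
  finally have e: "X ** Y = \<dots>" .
  have "X ** Z \<in> B"
    unfolding Z_def by (rule subalgebraD(4)[OF subalg assms coords_decompose])
  then show ?thesis
    unfolding e by (simp add: coords_add coords_scale coords_mem assms)
qed

text \<open>
  Some column \<open>j\<close> carries a nonzero functional \<open>w 2 j\<close>. By lemma \<open>coords_mult_left\<close> the
  common kernel of \<open>w 2 j\<close> and \<open>w 3 j\<close> is invariant under \<open>B\<close>. If the two are parallel,
  the kernel is a plane and its normal vector is an eigenvector of the transposes. If not,
  it is the line through their cross product.
\<close>

lemma common_eigenvector:
  "(\<exists>u. u \<noteq> 0 \<and> (\<forall>X\<in>B. \<exists>k. X *v u = k *s u)) \<or>
   (\<exists>w. w \<noteq> 0 \<and> (\<forall>X\<in>B. \<exists>k. transpose X *v w = k *s w))"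
proof -
  \<comment> \<open>The vector \<open>w c j\<close> represents the coordinate \<open>c\<close> as a functional of column \<open>j\<close>.\<close>
  define w where "w = (\<lambda>c j. (\<chi> k. coords (column_matrix j (axis k 1)) $ c) :: complex ^ 3)"
  have w: "coords (column_matrix j y) $ c = dot (w c j) y" for c j y
    by (subst column_matrix_expand) (simp add: coords_add coords_scale w_def dot_def mult.commute)
  obtain j where j: "w 2 j \<noteq> 0"
  proof -
    have "coords a $ 2 = dot (w 2 1) (column 1 a) + dot (w 2 2) (column 2 a) + dot (w 2 3) (column 3 a)"
      by (subst sum_columns) (simp add: coords_add w)
    then have "\<not> (w 2 1 = 0 \<and> w 2 2 = 0 \<and> w 2 3 = 0)"
      by (auto simp: coords_a dot_def)
    then show ?thesis using that by blast
  qed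
  have stable: "dot (w c j) (X *v y) =
      dot (w 2 j) y * coords (X ** a) $ c + dot (w 3 j) y * coords (X ** b) $ c"
    if "X \<in> B" for X y c
    using coords_mult_left[OF that, of "column_matrix j y"]
    by (simp add: w[symmetric] mult_column_matrix)
  define u where "u = cross (w 2 j) (w 3 j)"
  show ?thesis
  proof (cases "u = 0")
    case True
    then obtain m where m: "w 3 j = m *s w 2 j"
      using cross_eq_0_imp_parallel[OF j] by (auto simp: u_def)
    have "transpose X *v w 2 j = (coords (X ** a) $ 2 + m * coords (X ** b) $ 2) *s w 2 j"
      if X: "X \<in> B" for X
    proof -
      have "(transpose X *v w 2 j) $ i = dot (w 2 j) (X *v axis i 1)" for i
        using exhaust_3[of i]
        by (auto simp: dot_def matrix_vector_mult_def transpose_def sum_3 axis_def algebra_simps)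
      moreover have "dot (w 2 j) (X *v axis i 1) =
          (coords (X ** a) $ 2 + m * coords (X ** b) $ 2) * dot (w 2 j) (axis i 1)" for i
        unfolding stable[OF X] m by (simp add: dot_scale algebra_simps)
      moreover have "dot (w 2 j) (axis i 1) = w 2 j $ i" for i
        using exhaust_3[of i] by (auto simp: dot_def axis_def)
      ultimately show ?thesis by (simp add: vec_eq_iff algebra_simps)
    qed
    then show ?thesis using j by blast
  next
    case False
    have "\<exists>k. X *v u = k *s u" if X: "X \<in> B" for X
    proof (rule cross_eq_0_imp_parallel[OF False])
      have "dot (w c j) (X *v u) = 0" for c
        unfolding stable[OF X] by (simp add: u_def)
      then show "cross u (X *v u) = 0" by (simp add: u_def cross_cross)
    qed
    then show ?thesis using False by blast
  qed
qed

context
  fixes u :: "complex ^ 3"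
  assumes u: "u \<noteq> 0" and eigen: "\<And>X. X \<in> B \<Longrightarrow> \<exists>k. X *v u = k *s u"
begin

text \<open>
  Split \<open>X\<close> into its components along the identity, \<open>a\<close>, \<open>b\<close> and \<open>B\<close>; the last one maps
  \<open>u\<close> to \<open>k u\<close>.
\<close>

lemma mult_eigenvector:
  "\<exists>k. X *v u = frame_matrix u (a *v u) (b *v u) *v
    (vector [coords X $ 1 + k, coords X $ 2, coords X $ 3])"
proof -
  define Z where "Z = X - (coords X $ 1 *\<^sub>M mat 1 + coords X $ 2 *\<^sub>M a + coords X $ 3 *\<^sub>M b)"
  have "Z \<in> B" unfolding Z_def by (rule coords_decompose)
  then obtain k where k: "Z *v u = k *s u" using eigen by blast
  have "X *v u = (coords X $ 1 *\<^sub>M mat 1 + coords X $ 2 *\<^sub>M a + coords X $ 3 *\<^sub>M b + Z) *v u"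
    by (simp add: Z_def)
  also have "\<dots> = frame_matrix u (a *v u) (b *v u) *v
      (vector [coords X $ 1 + k, coords X $ 2, coords X $ 3])"
    by (simp add: frame_matrix_mult_vec matrix_vector_mult_add_rdistrib mat_scale_mult_vec k
        vector_sadd_rdistrib add_ac)
  finally show ?thesis by blast
qed

text \<open>
  Since \<open>u \<noteq> 0\<close>, every vector has the form \<open>X u\<close>, and the previous lemma puts it in the
  range of the frame.
\<close>

lemma frame_invertible: "invertible (frame_matrix u (a *v u) (b *v u))"
proof -
  obtain j where j: "u $ j \<noteq> 0" using u vec_nonzero_iff by blast
  have "\<exists>t. y = frame_matrix u (a *v u) (b *v u) *v t" for y
  proof -
    have "y = column_matrix j ((1 / u $ j) *s y) *v u" using j by (simp add: column_matrix_mult_vec)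
    then show ?thesis using mult_eigenvector[of "column_matrix j ((1 / u $ j) *s y)"] by auto
  qed
  then show ?thesis
    unfolding invertible_right_inverse matrix_right_invertible_surjective surj_def by blast
qed

lemma annihilator_coords:
  assumes X: "X *v u = 0"
  shows "coords X $ 2 = 0" "coords X $ 3 = 0"
proof -
  obtain k where "frame_matrix u (a *v u) (b *v u) *v
      (vector [coords X $ 1 + k, coords X $ 2, coords X $ 3]) = 0"
    using mult_eigenvector[of X] X by auto
  then have "(vector [coords X $ 1 + k, coords X $ 2, coords X $ 3] :: complex ^ 3) = 0"
    by (rule invertible_mult_vec_eq_0[OF frame_invertible])
  then show "coords X $ 2 = 0" "coords X $ 3 = 0" by (simp_all add: vec_eq_iff forall_3)
qed

text \<open>
  By the previous lemma, the annihilator of \<open>u\<close> lies in the sum of \<open>B\<close> and the scalars, in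
  which \<open>B\<close> is a two-sided ideal; the first coordinate is the quotient map.
\<close>

lemma coords_mult_annihilator:
  assumes X: "X *v u = 0" and Y: "Y *v u = 0"
  shows "coords (X ** Y) $ 1 = coords X $ 1 * coords Y $ 1"
proof -
  define x y where "x = coords X $ 1" and "y = coords Y $ 1"
  define X' Y' where "X' = X - x *\<^sub>M mat 1" and "Y' = Y - y *\<^sub>M mat 1"
  have m: "X' \<in> B" "Y' \<in> B"
    using coords_decompose[of X] coords_decompose[of Y] annihilator_coords X Y
    by (simp_all add: X'_def Y'_def x_def y_def)
  have "X ** Y - ((x * y) *\<^sub>M mat 1 + 0 *\<^sub>M a + 0 *\<^sub>M b) = x *\<^sub>M Y' + y *\<^sub>M X' + X' ** Y'"
    by (simp add: X'_def Y'_def matrix_ring_simps) (simp add: entrywise algebra_simps)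
  also have "\<dots> \<in> B" using m subalg by (intro subalgebraD)
  finally have "coords (X ** Y) = vector [x * y, 0, 0]" by (rule coords_eqI)
  then show ?thesis by (simp add: x_def y_def)
qed

text \<open>
  A multiplicative functional takes the same value on \<open>X Y\<close> and \<open>Y X\<close>. A rank-one matrix
  of square zero is a product \<open>X Y\<close> in the annihilator with \<open>Y X = 0\<close>, so the functional
  vanishes on it; and any rank-one matrix of the annihilator is a product whose second
  factor is of this kind.
\<close>

lemma coords_outer:
  assumes w: "dot w u = 0"
  shows "coords (outer z w) $ 1 = 0"
proof (cases "w = 0")
  case True
  then have "outer z w = 0" by (simp add: outer_def vec_eq_iff)
  then show ?thesis using coords_scale[of 0 0] by simp
next
  case w0: False
  have ann: "outer z v *v u = 0" if "dot v u = 0" for z v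
    using that by (simp add: outer_mult_vec)
  have c0: "coords 0 $ 1 = 0" using coords_scale[of 0 0] by simp
  have nilpotent: "coords (outer z w) $ 1 = 0" if z: "dot w z = 0" for z
  proof -
    obtain z' where z': "dot w z' = 1" using dot_eq_1[OF w0] .
    have "coords (outer z w) $ 1 = coords (outer z w ** outer z' w) $ 1"
      by (simp add: outer_mult_outer z')
    also have "\<dots> = coords (outer z' w ** outer z w) $ 1"
      by (simp add: coords_mult_annihilator ann w)
    also have "\<dots> = 0" by (simp add: outer_mult_outer z c0)
    finally show ?thesis .
  qed
  obtain y where y: "dot u y = 1" using dot_eq_1[OF u] .
  obtain x where x: "dot w x = 1" using dot_eq_1[OF w0] .
  \<comment> \<open>Chosen so that \<open>z'\<close> is orthogonal to \<open>w\<close> and \<open>w'\<close> to \<open>u\<close>, while \<open>dot w' z'\<close> is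
    \<open>dot u y * dot w x = 1\<close> by the Binet-Cauchy identity.\<close>
  define z' w' where "z' = cross y w" and "w' = cross u x"
  have "dot w' z' = 1"
    using x y w by (simp add: z'_def w'_def dot_cross_cross dot_commute)
  then have "outer z w = outer z w' ** outer z' w"
    by (simp add: outer_mult_outer)
  moreover have "dot w z' = 0" "dot w' u = 0"
    by (simp_all add: z'_def w'_def)
  ultimately show ?thesis
    using nilpotent[of z'] by (simp add: coords_mult_annihilator ann w)
qed

text \<open>
  A matrix that annihilates \<open>u\<close> is the sum of rank-one matrices formed from its rows, and
  these annihilate \<open>u\<close> too. So its first coordinate is zero, and it lies in \<open>B\<close>.
  Conversely, if \<open>X \<in> B\<close> has eigenvalue \<open>k\<close> at \<open>u\<close>, then \<open>X - k\<close> annihilates \<open>u\<close> and lies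
  in \<open>B\<close>, so \<open>B\<close> contains the scalar \<open>k\<close>, which must be zero.
\<close>

lemma eq_annihilator: "B = {X. X *v u = 0}"
proof -
  have sub: "X \<in> B" if X: "X *v u = 0" for X
  proof -
    have "dot (X $ i) u = 0" for i using X by (simp add: row_dot)
    then have "coords X $ 1 = 0"
      by (subst sum_outer_rows) (simp add: coords_add coords_outer)
    then show ?thesis using coords_decompose[of X] annihilator_coords[OF X] by simp
  qed
  moreover have "X *v u = 0" if X: "X \<in> B" for X
  proof -
    obtain k where k: "X *v u = k *s u" using eigen[OF X] by blast
    then have "X - k *\<^sub>M mat 1 \<in> B"
      by (intro sub) (simp add: matrix_vector_mult_diff_rdistrib mat_scale_mult_vec)
    then have "X - (X - k *\<^sub>M mat 1) \<in> B" using subalgebraD(2)[OF subalg X] by blast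
    then have "k = 0" using unique[of k 0 0] by simp
    then show ?thesis using k by simp
  qed
  ultimately show ?thesis by blast
qed

end

end

lemma mult_frame_matrix: "X ** frame_matrix u v w = frame_matrix (X *v u) (X *v v) (X *v w)"
  by (simp add: frame_matrix_def transpose_def matrix_matrix_mult_def matrix_vector_mult_def
      vec_eq_iff forall_3)

lemma frame_matrix_mult_mat_unit:
  "frame_matrix u v w ** mat_unit 2 1 = frame_matrix v 0 0"
  "frame_matrix u v w ** mat_unit 2 2 = frame_matrix 0 v 0"
  "frame_matrix u v w ** mat_unit 2 3 = frame_matrix 0 0 v"
  "frame_matrix u v w ** mat_unit 3 1 = frame_matrix w 0 0"
  "frame_matrix u v w ** mat_unit 3 2 = frame_matrix 0 w 0"
  "frame_matrix u v w ** mat_unit 3 3 = frame_matrix 0 0 w"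
  by (simp_all add: frame_matrix_def transpose_def matrix_matrix_mult_def mat_unit_def
      vec_eq_iff forall_3 sum_3)

lemma frame_matrix_add:
  "frame_matrix u v w + frame_matrix u' v' w' = frame_matrix (u + u') (v + v') (w + w')"
  by (simp add: frame_matrix_def transpose_def vec_eq_iff forall_3)

section \<open>Normal forms in an adapted frame\<close>

lemma automorphism_conjugation:
  fixes G H :: "'a::field ^ 'n ^ 'n"
  assumes "H ** G = mat 1" "G ** H = mat 1"
  shows "automorphism (\<lambda>X. H ** X ** G)"
  unfolding automorphism_def
proof (intro conjI allI)
  show "Vector_Spaces.linear (*\<^sub>M) (*\<^sub>M) (\<lambda>X. H ** X ** G)"
    by (simp add: Vector_Spaces.linear_iff matsp.vector_space_axioms matrix_ring_simps)
  have 1: "H ** (G ** X ** H) ** G = X" for X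
  proof -
    have "H ** (G ** X ** H) ** G = (H ** G) ** X ** (H ** G)" by (simp only: matrix_mul_assoc)
    then show ?thesis using assms by simp
  qed
  have 2: "G ** (H ** X ** G) ** H = X" for X
  proof -
    have "G ** (H ** X ** G) ** H = (G ** H) ** X ** (G ** H)" by (simp only: matrix_mul_assoc)
    then show ?thesis using assms by simp
  qed
  show "bij (\<lambda>X. H ** X ** G)"
    by (rule o_bij[of "\<lambda>X. G ** X ** H"]) (simp_all add: fun_eq_iff 1 2)
  show "H ** mat 1 ** G = mat 1" using assms by simp
  show "H ** (X ** Y) ** G = H ** X ** G ** (H ** Y ** G)" for X Y
  proof -
    have "H ** X ** G ** (H ** Y ** G) = H ** (X ** (G ** H) ** Y) ** G"
      by (simp only: matrix_mul_assoc)
    then show ?thesis using assms by simp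
  qed
qed

lemma annihilator_first_axis:
  "{X. X *v axis 1 1 = 0} = matsp.span {mat_unit 1 2, mat_unit 1 3, mat_unit 2 2, mat_unit 2 3,
     mat_unit 3 2, mat_unit 3 3 :: 'a::field ^ 3 ^ 3}"  (is "?L = matsp.span ?U")
proof
  have iff: "X *v axis 1 1 = 0 \<longleftrightarrow> (\<forall>i. X $ i $ 1 = 0)" for X :: "'a ^ 3 ^ 3"
    by (simp add: matrix_vector_mult_def axis_def vec_eq_iff sum_3)
  show "?L \<subseteq> matsp.span ?U"
  proof
    fix X assume "X \<in> ?L"
    then have "X $ 1 $ 1 = 0" "X $ 2 $ 1 = 0" "X $ 3 $ 1 = 0" by (simp_all add: iff)
    then have "X = X $ 1 $ 2 *\<^sub>M mat_unit 1 2 + X $ 1 $ 3 *\<^sub>M mat_unit 1 3 + X $ 2 $ 2 *\<^sub>M mat_unit 2 2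
      + X $ 2 $ 3 *\<^sub>M mat_unit 2 3 + X $ 3 $ 2 *\<^sub>M mat_unit 3 2 + X $ 3 $ 3 *\<^sub>M mat_unit 3 3"
      by (simp add: entrywise mat_unit_def forall_3)
    also have "\<dots> \<in> matsp.span ?U"
      by (intro matsp.span_add matsp.span_scale matsp.span_base) simp_all
    finally show "X \<in> matsp.span ?U" .
  qed
  show "matsp.span ?U \<subseteq> ?L"
  proof (rule matsp.span_minimal)
    show "?U \<subseteq> ?L" by (auto simp: iff mat_unit_def)
    show "matsp.subspace ?L"
      by (auto simp: matsp.subspace_def matrix_vector_mult_add_rdistrib mat_scale_mult_vec)
  qed
qed

text \<open>
  One subalgebra for each case of \<open>normal_table\<close>, in the same order.
\<close>

definition listed_form :: "(complex ^ 3 ^ 3) set \<Rightarrow> bool"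
  where "listed_form S \<longleftrightarrow>
     S = matsp.span {mat 1, mat_unit 2 1, mat_unit 3 1} \<or>
     S = matsp.span {mat 1, mat_unit 2 1, mat_unit 3 1 + mat_unit 2 3} \<or>
     S = matsp.span {mat 1, mat_unit 2 1 + mat_unit 2 2, mat_unit 3 1} \<or>
     S = matsp.span {mat 1, mat_unit 2 1 + mat_unit 2 2 + mat_unit 3 3, mat_unit 3 1} \<or>
     S = matsp.span {mat 1, mat_unit 2 1 + mat_unit 2 2, mat_unit 3 1 + mat_unit 3 2} \<or>
     S = matsp.span {mat 1, mat_unit 2 1 + mat_unit 2 2, mat_unit 3 1 + mat_unit 3 3}"

text \<open>
  The map is conjugation by the matrix \<open>G\<close> with columns \<open>u\<close>, \<open>a u\<close>, \<open>b u\<close>. It moves \<open>u\<close> to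
  the first unit vector, hence \<open>B\<close> to the annihilator of that vector. The columns of \<open>a G\<close>
  are \<open>a u\<close>, \<open>a\<^sup>2 u\<close>, \<open>a b u\<close>; the multiplication table rewrites them as combinations of
  columns of \<open>G\<close>, and the coefficients are the entries of the conjugate of \<open>a\<close>.
\<close>

lemma normal_form_of_eigenvector:
  assumes B: "complement_basis B a b" and table: "normal_table a b"
    and u: "u \<noteq> 0" "\<forall>X\<in>B. \<exists>k. X *v u = k *s u"
  shows "\<exists>\<phi>. automorphism \<phi> \<and>
    \<phi> ` B = matsp.span {mat_unit 1 2, mat_unit 1 3, mat_unit 2 2, mat_unit 2 3,
                         mat_unit 3 2, mat_unit 3 3} \<and>
    listed_form (\<phi> ` matsp.span {mat 1, a, b})"
proof -
  interpret complement_basis B a b by (rule B)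
  define G where "G = frame_matrix u (a *v u) (b *v u)"
  have "invertible G" unfolding G_def using frame_invertible u by blast
  then obtain H where H: "G ** H = mat 1" "H ** G = mat 1" unfolding invertible_def by blast
  define \<phi> where "\<phi> X = H ** X ** G" for X
  have aut: "automorphism \<phi>" unfolding \<phi>_def using H by (intro automorphism_conjugation)
  have \<phi>I: "\<phi> X = T" if "X ** G = G ** T" for X T
  proof -
    have "\<phi> X = H ** (X ** G)" by (simp only: \<phi>_def matrix_mul_assoc)
    also have "\<dots> = (H ** G) ** T" by (simp only: that matrix_mul_assoc)
    finally show ?thesis using H by simp
  qed
  have G1: "G *v axis 1 1 = u" by (simp add: G_def frame_matrix_mult_vec axis_def)
  have "\<phi> ` {X. X *v u = 0} = {X. X *v axis 1 1 = 0}"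
  proof (intro equalityI subsetI)
    fix Y assume "Y \<in> \<phi> ` {X. X *v u = 0}"
    then obtain X where "X *v u = 0" "Y = H ** X ** G" by (auto simp: \<phi>_def)
    then show "Y \<in> {X. X *v axis 1 1 = 0}"
      by (simp add: matrix_vector_mul_assoc[symmetric] G1)
  next
    fix Y :: "complex ^ 3 ^ 3" assume Y: "Y \<in> {X. X *v axis 1 1 = 0}"
    have "H *v u = (H ** G) *v axis 1 1" by (simp only: matrix_vector_mul_assoc[symmetric] G1)
    then have "H *v u = axis 1 1" using H by simp
    then have "(G ** Y ** H) *v u = 0" using Y by (simp add: matrix_vector_mul_assoc[symmetric])
    moreover have "\<phi> (G ** Y ** H) = Y"
    proof (rule \<phi>I)
      have "G ** Y ** H ** G = G ** Y ** (H ** G)" by (simp only: matrix_mul_assoc)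
      then show "G ** Y ** H ** G = G ** Y" using H by simp
    qed
    ultimately show "Y \<in> \<phi> ` {X. X *v u = 0}"
      by (intro image_eqI[of _ _ "G ** Y ** H"]) simp_all
  qed
  moreover have "B = {X. X *v u = 0}" using eq_annihilator u by blast
  ultimately have \<phi>B: "\<phi> ` B = matsp.span {mat_unit 1 2, mat_unit 1 3, mat_unit 2 2, mat_unit 2 3,
                         mat_unit 3 2, mat_unit 3 3}"
    using annihilator_first_axis by simp
  have lin: "\<phi> (x *\<^sub>M mat 1 + y *\<^sub>M a + z *\<^sub>M b) = x *\<^sub>M mat 1 + y *\<^sub>M \<phi> a + z *\<^sub>M \<phi> b" for x y z
    using H by (simp add: \<phi>_def matrix_ring_simps)
  have \<phi>A: "\<phi> ` matsp.span {mat 1, a, b} = matsp.span {mat 1, \<phi> a, \<phi> b}"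
  proof (intro equalityI subsetI)
    fix Y assume "Y \<in> \<phi> ` matsp.span {mat 1, a, b}"
    then obtain x y z where "Y = \<phi> (x *\<^sub>M mat 1 + y *\<^sub>M a + z *\<^sub>M b)"
      by (auto simp: mem_span_3)
    then show "Y \<in> matsp.span {mat 1, \<phi> a, \<phi> b}" unfolding lin mem_span_3 by blast
  next
    fix Y assume "Y \<in> matsp.span {mat 1, \<phi> a, \<phi> b}"
    then obtain x y z where "Y = \<phi> (x *\<^sub>M mat 1 + y *\<^sub>M a + z *\<^sub>M b)"
      unfolding lin mem_span_3 by blast
    moreover have "x *\<^sub>M mat 1 + y *\<^sub>M a + z *\<^sub>M b \<in> matsp.span {mat 1, a, b}"
      unfolding mem_span_3 by blast
    ultimately show "Y \<in> \<phi> ` matsp.span {mat 1, a, b}" by blast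
  qed
  note frame = G_def mult_frame_matrix matrix_vector_mul_assoc matrix_mult_add
    frame_matrix_mult_mat_unit frame_matrix_add
  from table have "listed_form (matsp.span {mat 1, \<phi> a, \<phi> b})"
    unfolding normal_table_def
  proof (elim disjE conjE)
    assume t: "a ** a = 0" "a ** b = 0" "b ** a = 0" "b ** b = 0"
    have "\<phi> a = mat_unit 2 1" by (rule \<phi>I) (simp add: frame t)
    moreover have "\<phi> b = mat_unit 3 1" by (rule \<phi>I) (simp add: frame t)
    ultimately show ?thesis by (simp add: listed_form_def)
  next
    assume t: "a ** a = 0" "a ** b = 0" "b ** a = 0" "b ** b = a"
    have "\<phi> a = mat_unit 2 1" by (rule \<phi>I) (simp add: frame t)
    moreover have "\<phi> b = mat_unit 3 1 + mat_unit 2 3" by (rule \<phi>I) (simp add: frame t)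
    ultimately show ?thesis by (simp add: listed_form_def)
  next
    assume t: "a ** a = a" "a ** b = 0" "b ** a = 0" "b ** b = 0"
    have "\<phi> a = mat_unit 2 1 + mat_unit 2 2" by (rule \<phi>I) (simp add: frame t)
    moreover have "\<phi> b = mat_unit 3 1" by (rule \<phi>I) (simp add: frame t)
    ultimately show ?thesis by (simp add: listed_form_def)
  next
    assume t: "a ** a = a" "a ** b = b" "b ** a = 0" "b ** b = 0"
    have "\<phi> a = mat_unit 2 1 + mat_unit 2 2 + mat_unit 3 3" by (rule \<phi>I) (simp add: frame t)
    moreover have "\<phi> b = mat_unit 3 1" by (rule \<phi>I) (simp add: frame t)
    ultimately show ?thesis by (simp add: listed_form_def)
  next
    assume t: "a ** a = a" "a ** b = 0" "b ** a = b" "b ** b = 0"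
    have "\<phi> a = mat_unit 2 1 + mat_unit 2 2" by (rule \<phi>I) (simp add: frame t)
    moreover have "\<phi> b = mat_unit 3 1 + mat_unit 3 2" by (rule \<phi>I) (simp add: frame t)
    ultimately show ?thesis by (simp add: listed_form_def)
  next
    assume t: "a ** a = a" "a ** b = 0" "b ** a = 0" "b ** b = b"
    have "\<phi> a = mat_unit 2 1 + mat_unit 2 2" by (rule \<phi>I) (simp add: frame t)
    moreover have "\<phi> b = mat_unit 3 1 + mat_unit 3 3" by (rule \<phi>I) (simp add: frame t)
    ultimately show ?thesis by (simp add: listed_form_def)
  qed
  then show ?thesis using aut \<phi>B by (intro exI[of _ \<phi>]) (simp add: \<phi>A)
qed

section \<open>Transposition\<close>

lemma transpose_linear:
  "transpose (X + Y) = transpose X + transpose Y" "transpose (X - Y) = transpose X - transpose Y"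
  "transpose (c *\<^sub>M X) = c *\<^sub>M transpose X" "transpose 0 = 0"
  for X Y :: "'a::field ^ 'n ^ 'm"
  by (simp_all add: transpose_def entrywise)

lemma mem_transpose_image: "X \<in> transpose ` B \<longleftrightarrow> transpose X \<in> B"
proof
  assume "transpose X \<in> B"
  then have "transpose (transpose X) \<in> transpose ` B" by (rule imageI)
  then show "X \<in> transpose ` B" by simp
qed auto

lemma subalgebra_transpose: "subalgebra B \<Longrightarrow> subalgebra (transpose ` B)"
  by (auto simp: subalgebra_def matsp.subspace_def mem_transpose_image transpose_linear
      matrix_transpose_mul)

lemma complement_basis_transpose:
  assumes "complement_basis B a b"
  shows "complement_basis (transpose ` B) (transpose a) (transpose b)"
proof -
  interpret complement_basis B a b by (rule assms)
  show ?thesis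
  proof
    show "subalgebra (transpose ` B)" by (rule subalgebra_transpose[OF subalg])
    fix X :: "complex ^ 3 ^ 3"
    obtain x y z where "transpose X - (x *\<^sub>M mat 1 + y *\<^sub>M a + z *\<^sub>M b) \<in> B"
      using decompose by blast
    then show "\<exists>x y z. X - (x *\<^sub>M mat 1 + y *\<^sub>M transpose a + z *\<^sub>M transpose b) \<in> transpose ` B"
      by (intro exI[of _ x] exI[of _ y] exI[of _ z])
        (simp add: mem_transpose_image transpose_linear transpose_mat)
  next
    fix x y z
    assume "x *\<^sub>M mat 1 + y *\<^sub>M transpose a + z *\<^sub>M transpose b \<in> transpose ` B"
    then show "x = 0 \<and> y = 0 \<and> z = 0"
      by (intro unique) (simp add: mem_transpose_image transpose_linear transpose_mat)
  qed
qed

lemma normal_table_transpose: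
  assumes "normal_table a b"
  shows "normal_table (transpose a) (transpose b)"
  using assms unfolding normal_table_def
  by (elim disjE conjE) (simp_all add: matrix_transpose_mul[symmetric] transpose_linear)

lemma transpose_span_3:
  "transpose ` matsp.span {mat 1, a, b} = matsp.span {mat 1, transpose a, transpose b}"
  for a b :: "complex ^ 3 ^ 3"
proof (intro set_eqI)
  fix X :: "complex ^ 3 ^ 3"
  have "transpose X = x *\<^sub>M mat 1 + y *\<^sub>M a + z *\<^sub>M b \<longleftrightarrow>
      transpose (transpose X) = transpose (x *\<^sub>M mat 1 + y *\<^sub>M a + z *\<^sub>M b)" for x y z
    by (simp only: transpose_iff)
  then have "transpose X = x *\<^sub>M mat 1 + y *\<^sub>M a + z *\<^sub>M b \<longleftrightarrow>
      X = x *\<^sub>M mat 1 + y *\<^sub>M transpose a + z *\<^sub>M transpose b" for x y z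
    by (simp add: transpose_linear transpose_mat)
  then show "X \<in> transpose ` matsp.span {mat 1, a, b} \<longleftrightarrow>
      X \<in> matsp.span {mat 1, transpose a, transpose b}"
    by (simp add: mem_transpose_image mem_span_3)
qed

section \<open>Classification of the decompositions\<close>

lemma complement_basisI:
  assumes A: "A = matsp.span {mat 1, a, b}" and i: "independent_3 (mat 1) a b" and B: "subalgebra B"
    and int: "A \<inter> B = {0}" and sum: "{X + Y | X Y. X \<in> A \<and> Y \<in> B} = UNIV"
  shows "complement_basis B a b"
proof
  show "subalgebra B" by (rule B)
  fix X :: "complex ^ 3 ^ 3"
  obtain P Q where "X = P + Q" "P \<in> A" "Q \<in> B" using sum by blast
  moreover obtain x y z where "P = x *\<^sub>M mat 1 + y *\<^sub>M a + z *\<^sub>M b"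
    using \<open>P \<in> A\<close> unfolding A mem_span_3 by blast
  ultimately have "X - (x *\<^sub>M mat 1 + y *\<^sub>M a + z *\<^sub>M b) \<in> B" by simp
  then show "\<exists>x y z. X - (x *\<^sub>M mat 1 + y *\<^sub>M a + z *\<^sub>M b) \<in> B" by blast
next
  fix x y z assume "x *\<^sub>M mat 1 + y *\<^sub>M a + z *\<^sub>M b \<in> B"
  moreover have "x *\<^sub>M mat 1 + y *\<^sub>M a + z *\<^sub>M b \<in> A" unfolding A mem_span_3 by blast
  ultimately have "x *\<^sub>M mat 1 + y *\<^sub>M a + z *\<^sub>M b = 0" using int by blast
  then show "x = 0 \<and> y = 0 \<and> z = 0" using independent_3D[OF i] by blast
qed

text \<open>
  When the eigenvector belongs to the transpose of \<open>B\<close>, the adapted frame is built for the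
  transposed decomposition, and composing with the transpose gives an antiautomorphism.
\<close>

lemma normal_form:
  assumes "subalgebra A" and "subalgebra B"
    and "A \<inter> B = {0}" and "{X + Y | X Y. X \<in> A \<and> Y \<in> B} = UNIV"
    and "matsp.dim A = 3" and "unital A"
  shows "\<exists>\<phi>. (automorphism \<phi> \<or> antiautomorphism \<phi>) \<and>
    \<phi> ` B = matsp.span {mat_unit 1 2, mat_unit 1 3, mat_unit 2 2, mat_unit 2 3,
                         mat_unit 3 2, mat_unit 3 3} \<and> listed_form (\<phi> ` A)"
proof -
  have 1: "mat 1 \<in> A" using assms(6) by (simp add: unital_def)
  obtain a b where ab: "a \<in> A" "b \<in> A" "independent_3 (mat 1) a b" "normal_table a b"
    using unital_3dim_has_normal_basis[OF assms(1) 1 assms(5)] unfolding has_normal_basis_def by blast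
  have A: "A = matsp.span {mat 1, a, b}"
    using span_of_independent_3[of A] assms(1,5) 1 ab by (auto simp: subalgebra_def)
  have B: "complement_basis B a b" by (rule complement_basisI[OF A ab(3) assms(2-4)])
  from complement_basis.common_eigenvector[OF B] show ?thesis
  proof (elim disjE exE conjE)
    fix u assume "u \<noteq> 0" "\<forall>X\<in>B. \<exists>k. X *v u = k *s u"
    then show ?thesis using normal_form_of_eigenvector[OF B ab(4)] unfolding A by blast
  next
    fix w assume w: "w \<noteq> 0" "\<forall>X\<in>B. \<exists>k. transpose X *v w = k *s w"
    then have "\<forall>X\<in>transpose ` B. \<exists>k. X *v w = k *s w" by blast
    from normal_form_of_eigenvector[OF complement_basis_transpose[OF B]
        normal_table_transpose[OF ab(4)] w(1) this]
    obtain \<psi> where \<psi>: "automorphism \<psi>"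
      "\<psi> ` transpose ` B = matsp.span {mat_unit 1 2, mat_unit 1 3, mat_unit 2 2, mat_unit 2 3,
                         mat_unit 3 2, mat_unit 3 3}"
      "listed_form (\<psi> ` transpose ` A)"
      unfolding A transpose_span_3 by blast
    then have "antiautomorphism (\<psi> \<circ> transpose)" unfolding antiautomorphism_def by blast
    then show ?thesis using \<psi>(2,3) by (intro exI[of _ "\<psi> \<circ> transpose"]) (simp add: image_comp)
  qed
qed

theorem theorem2:
  fixes A B :: "(complex ^ 3 ^ 3) set"
  assumes "subalgebra A" and "subalgebra B"
    and "A \<inter> B = {0}" and "{X + Y | X Y. X \<in> A \<and> Y \<in> B} = UNIV"
    and "matsp.dim A = 3" and "matsp.dim B = 6"
    and "unital A"
  shows "\<exists>\<phi> S. (automorphism \<phi> \<or> antiautomorphism \<phi>) \<and>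
    \<phi> ` B = matsp.span {mat_unit 1 2, mat_unit 1 3, mat_unit 2 2, mat_unit 2 3,
                         mat_unit 3 2, mat_unit 3 3} \<and>
    \<phi> ` A = S \<and>
    (S = matsp.span {mat 1, mat_unit 2 1, mat_unit 3 1} \<or>
     S = matsp.span {mat 1, mat_unit 2 1, mat_unit 3 1 + mat_unit 2 3} \<or>
     S = matsp.span {mat 1, mat_unit 2 1 + mat_unit 2 2, mat_unit 3 1} \<or>
     S = matsp.span {mat 1, mat_unit 2 1 + mat_unit 2 2 + mat_unit 3 3,
                      mat_unit 3 1 + mat_unit 3 2} \<or>
     S = matsp.span {mat 1, mat_unit 2 1 + mat_unit 2 2 + mat_unit 3 3, mat_unit 3 1} \<or>
     S = matsp.span {mat 1, mat_unit 2 1 + mat_unit 2 2, mat_unit 3 1 + mat_unit 3 2} \<or>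
     S = matsp.span {mat 1, mat_unit 2 1 + mat_unit 2 2, mat_unit 3 1 + mat_unit 3 3} \<or>
     (\<exists>y. y \<noteq> 0 \<and>
       S = matsp.span {mat 1,
             mat_unit 2 1 + (1 - y) *\<^sub>M mat_unit 2 2 + mat_unit 2 3,
             mat_unit 3 1 + mat_unit 2 2 + mat_unit 2 3 + y *\<^sub>M mat_unit 3 3}) \<or>
     (\<exists>y. y \<noteq> 0 \<and>
       S = matsp.span {mat 1,
             mat_unit 2 1 + mat_unit 2 2 + mat_unit 3 3,
             mat_unit 3 1 + mat_unit 3 2 + mat_unit 2 3 + y *\<^sub>M mat_unit 3 3}) \<or>
     (\<exists>d f. f \<noteq> 0 \<and>
       S = matsp.span {mat 1,
             vector [vector [0, 0, 0],
                     vector [1, d, 1],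
                     vector [0, 1 / f, 1]],
             vector [vector [0, 0, 0],
                     vector [0, 1, f],
                     vector [1, 1, 1 + f * (1 - d)]]}) \<or>
     (\<exists>d.
       S = matsp.span {mat 1,
             mat_unit 2 1 + mat_unit 1 3 + d *\<^sub>M mat_unit 2 3 + mat_unit 3 2,
             mat_unit 3 1 + mat_unit 1 2 + mat_unit 2 3 + d *\<^sub>M (mat_unit 2 2 + mat_unit 3 3)}) \<or>
     (\<exists>e u. e \<noteq> 0 \<and> e * u \<noteq> 1 \<and>
       S = matsp.span {mat 1,
             vector [vector [0, 0, e * u - 1],
                     vector [1, 1, 1],
                     vector [0, e, 1]],
             vector [vector [0, e * u - 1, 0],
                     vector [0, 1, u],
                     vector [1, 1, 1]]}))"
proof -
  obtain \<phi> where "automorphism \<phi> \<or> antiautomorphism \<phi>"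
    "\<phi> ` B = matsp.span {mat_unit 1 2, mat_unit 1 3, mat_unit 2 2, mat_unit 2 3,
                         mat_unit 3 2, mat_unit 3 3}" "listed_form (\<phi> ` A)"
    using normal_form[OF assms(1-5,7)] by blast
  then show ?thesis
    unfolding listed_form_def
    by (intro exI[of _ \<phi>] exI[of _ "\<phi> ` A"] conjI refl) (assumption | elim disjE, simp_all only: simp_thms)+
qed

end
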